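(* Let $\Phi$ be a TD system on $V$ of $q$-Racah type with diameter $d\ge 1$ and associated nonzero scalars $q,a,b\in\mathbb{K}$, and let $K,B\in\mathrm{End}(V)$ be the associated linear transformations defined from the first and second split decompositions of $V$. Then $$aK^2-\frac{a^{-1}q-aq^{-1}}{q-q^{-1}}\,KB-\frac{aq-a^{-1}q^{-1}}{q-q^{-1}}\,BK+a^{-1}B^2=0.$$
   Context: Let $\mathbb{K}$ be an algebraically closed field, $V$ a nonzero finite-dimensional $\mathbb{K}$-vector space, $\mathrm{End}(V)$ the algebra of linear maps $V\to V$, and $I$ the identity. TD pairs and systems. A tridiagonal (TD) pair on $V$ is an ordered pair $A,A^*\in\mathrm{End}(V)$ such that: (i) each of $A,A^*$ is diagonalizable; (ii) there is an ordering $\{V_i\}_{i=0}^d$ of the eigenspaces of $A$ with $A^*V_i\subseteq V_{i-1}+V_i+V_{i+1}$ for $0\le i\le d$ ($V_{-1}=V_{d+1}=0$); (iii) there is an ordering $\{V_i^*\}_{i=0}^\delta$ of the eigenspaces of $A^*$ with $AV_i^*\subseteq V_{i-1}^*+V_i^*+V_{i+1}^*$ for $0\le i\le \delta$ ($V^*_{-1}=V^*_{\delta+1}=0$); (iv) there is no subspace $W$ with $AW\subseteq W$, $A^*W\subseteq W$, $W\ne0$, $W\neq V$. It is known that $d=\delta$ (the diameter); assume $d\ge1$. Orderings as in (ii), (iii) are called standard. The primitive idempotent for an eigenspace of a diagonalizable map is the projection onto it along the sum of the other eigenspaces; an ordering of the primitive idempotents is standard if the corresponding ordering of eigenspaces is.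 A TD system on $V$ is a sequence $\Phi=(A;\{E_i\}_{i=0}^d;A^*;\{E_i^*\}_{i=0}^d)$ where $A,A^*$ is a TD pair on $V$ and $\{E_i\}$ (resp. $\{E_i^*\}$) is a standard ordering of the primitive idempotents of $A$ (resp. $A^*$). Let $\theta_i$ (resp. $\theta_i^*$) be the eigenvalue of $A$ (resp. $A^*$) for $E_i$ (resp. $E_i^*$). $\Phi$ has $q$-Racah type, with scalars $q,a,b$, if $q,a,b\in\mathbb{K}$ are nonzero, $q^4\ne1$, and $\theta_i=aq^{d-2i}+a^{-1}q^{2i-d}$, $\theta_i^*=bq^{d-2i}+b^{-1}q^{2i-d}$ for $0\le i\le d$. Split decompositions. For $0\le i\le d$ let $U_i=(E_0^*V+\cdots+E_i^*V)\cap(E_iV+\cdots+E_dV)$ and $U_i^\Downarrow=(E_0^*V+\cdots+E_i^*V)\cap(E_0V+\cdots+E_{d-i}V)$. It is known that $V=\bigoplus_{i=0}^dU_i=\bigoplus_{i=0}^dU_i^\Downarrow$ (the first and second split decompositions), with all summands nonzero. The maps. $K\in\mathrm{End}(V)$ acts on $U_i$ as $q^{d-2i}I$, and $B\in\mathrm{End}(V)$ acts on $U_i^\Downarrow$ as $q^{d-2i}I$, for $0\le i\le d$. Both are invertible. *)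

theory Defs
  imports "HOL-Computational_Algebra.Polynomial" "HOL-Library.Set_Algebras"
begin

definition linear_op ::
    "('k::field \<Rightarrow> 'v::ab_group_add \<Rightarrow> 'v)
      \<Rightarrow> ('v \<Rightarrow> 'v) \<Rightarrow> bool" where
  "linear_op s X \<longleftrightarrow> Vector_Spaces.linear s s X"

definition eigenspace ::
    "('k::field \<Rightarrow> 'v::ab_group_add \<Rightarrow> 'v)
      \<Rightarrow> ('v \<Rightarrow> 'v) \<Rightarrow> 'k \<Rightarrow> 'v set" where
  "eigenspace s X t = {v. X v = s t v}"

definition eigenspaces ::
    "('k::field \<Rightarrow> 'v::ab_group_add \<Rightarrow> 'v)
      \<Rightarrow> ('v \<Rightarrow> 'v) \<Rightarrow> 'v set set" where
  "eigenspaces s X = {eigenspace s X t |t. eigenspace s X t \<noteq> {0}}"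

definition diagonalizable ::
    "('k::field \<Rightarrow> 'v::ab_group_add \<Rightarrow> 'v)
      \<Rightarrow> ('v \<Rightarrow> 'v) \<Rightarrow> bool" where
  "diagonalizable s X \<longleftrightarrow> linear_op s X \<and> module.span s (\<Union>(eigenspaces s X)) = UNIV"

text \<open>The components of an ordering \<open>V\<^sub>0, \<dots>, V\<^sub>d\<close>, extended by the zero subspace to all
  integer indices, so that \<open>V\<^bsub>-1\<^esub> = V\<^bsub>d+1\<^esub> = 0\<close>.\<close>

definition component :: "nat \<Rightarrow> (nat \<Rightarrow> 'v::ab_group_add set) \<Rightarrow> int \<Rightarrow> 'v set" where
  "component d V k = (if 0 \<le> k \<and> k \<le> int d then V (nat k) else {0})"

text \<open>Sums of subspaces, here and below, are the elementwise sums of sets of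
  \<^theory>\<open>HOL-Library.Set_Algebras\<close>.\<close>

definition standard_ordering ::
    "('k::field \<Rightarrow> 'v::ab_group_add \<Rightarrow> 'v)
      \<Rightarrow> ('v \<Rightarrow> 'v) \<Rightarrow> ('v \<Rightarrow> 'v) \<Rightarrow> nat \<Rightarrow> (nat \<Rightarrow> 'v set) \<Rightarrow> bool" where
  "standard_ordering s A A' d V \<longleftrightarrow>
     bij_betw V {0..d} (eigenspaces s A) \<and>
     (\<forall>i\<in>{0..d}. A' ` V i \<subseteq>
        component d V (int i - 1) + component d V (int i) + component d V (int i + 1))"

definition TD_pair ::
    "('k::field \<Rightarrow> 'v::ab_group_add \<Rightarrow> 'v)
      \<Rightarrow> ('v \<Rightarrow> 'v) \<Rightarrow> ('v \<Rightarrow> 'v) \<Rightarrow> bool" where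
  "TD_pair s A A' \<longleftrightarrow>
     diagonalizable s A \<and> diagonalizable s A' \<and>
     (\<exists>d V. standard_ordering s A A' d V) \<and>
     (\<exists>\<delta> V'. standard_ordering s A' A \<delta> V') \<and>
     \<not> (\<exists>W. module.subspace s W \<and> A ` W \<subseteq> W \<and> A' ` W \<subseteq> W \<and> W \<noteq> {0} \<and> W \<noteq> UNIV)"

text \<open>\<open>P\<close> is the projection onto the eigenspace \<open>W\<close> of \<open>X\<close> along the sum of the other
  eigenspaces of \<open>X\<close>.\<close>

definition primitive_idempotent ::
    "('k::field \<Rightarrow> 'v::ab_group_add \<Rightarrow> 'v)
      \<Rightarrow> ('v \<Rightarrow> 'v) \<Rightarrow> 'v set \<Rightarrow> ('v \<Rightarrow> 'v) \<Rightarrow> bool" where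
  "primitive_idempotent s X W P \<longleftrightarrow>
     W \<in> eigenspaces s X \<and> linear_op s P \<and>
     (\<forall>v\<in>W. P v = v) \<and> (\<forall>v\<in>module.span s (\<Union>(eigenspaces s X - {W})). P v = 0)"

definition standard_idempotents ::
    "('k::field \<Rightarrow> 'v::ab_group_add \<Rightarrow> 'v)
      \<Rightarrow> ('v \<Rightarrow> 'v) \<Rightarrow> ('v \<Rightarrow> 'v) \<Rightarrow> nat \<Rightarrow> (nat \<Rightarrow> 'v \<Rightarrow> 'v) \<Rightarrow> bool" where
  "standard_idempotents s A A' d E \<longleftrightarrow>
     (\<exists>V. standard_ordering s A A' d V \<and> (\<forall>i\<in>{0..d}. primitive_idempotent s A (V i) (E i)))"

definition TD_system ::
    "('k::field \<Rightarrow> 'v::ab_group_add \<Rightarrow> 'v)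
      \<Rightarrow> nat \<Rightarrow> ('v \<Rightarrow> 'v) \<Rightarrow> (nat \<Rightarrow> 'v \<Rightarrow> 'v) \<Rightarrow> ('v \<Rightarrow> 'v) \<Rightarrow> (nat \<Rightarrow> 'v \<Rightarrow> 'v) \<Rightarrow> bool" where
  "TD_system s d A E A' E' \<longleftrightarrow>
     TD_pair s A A' \<and> standard_idempotents s A A' d E \<and> standard_idempotents s A' A d E'"

text \<open>The eigenvalue of \<open>X\<close> for its primitive idempotent \<open>P\<close>; it is unique because
  \<open>range P\<close> is a nonzero eigenspace.\<close>

definition eigenvalue_for ::
    "('k::field \<Rightarrow> 'v::ab_group_add \<Rightarrow> 'v)
      \<Rightarrow> ('v \<Rightarrow> 'v) \<Rightarrow> ('v \<Rightarrow> 'v) \<Rightarrow> 'k" where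
  "eigenvalue_for s X P = (THE t. eigenspace s X t = range P)"

definition q_Racah ::
    "('k::field \<Rightarrow> 'v::ab_group_add \<Rightarrow> 'v)
      \<Rightarrow> nat \<Rightarrow> ('v \<Rightarrow> 'v) \<Rightarrow> (nat \<Rightarrow> 'v \<Rightarrow> 'v) \<Rightarrow> ('v \<Rightarrow> 'v) \<Rightarrow> (nat \<Rightarrow> 'v \<Rightarrow> 'v)
      \<Rightarrow> 'k \<Rightarrow> 'k \<Rightarrow> 'k \<Rightarrow> bool" where
  "q_Racah s d A E A' E' q a b \<longleftrightarrow>
     q \<noteq> 0 \<and> a \<noteq> 0 \<and> b \<noteq> 0 \<and> q ^ 4 \<noteq> 1 \<and>
     (\<forall>i\<in>{0..d}.
        eigenvalue_for s A (E i) =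
          a * q powi (int d - 2 * int i) + inverse a * q powi (2 * int i - int d) \<and>
        eigenvalue_for s A' (E' i) =
          b * q powi (int d - 2 * int i) + inverse b * q powi (2 * int i - int d))"

definition split1 ::
    "nat \<Rightarrow> (nat \<Rightarrow> 'v::ab_group_add \<Rightarrow> 'v) \<Rightarrow> (nat \<Rightarrow> 'v \<Rightarrow> 'v) \<Rightarrow> nat \<Rightarrow> 'v set" where
  "split1 d E E' i = (\<Sum>j\<in>{0..i}. range (E' j)) \<inter> (\<Sum>j\<in>{i..d}. range (E j))"

definition split2 ::
    "nat \<Rightarrow> (nat \<Rightarrow> 'v::ab_group_add \<Rightarrow> 'v) \<Rightarrow> (nat \<Rightarrow> 'v \<Rightarrow> 'v) \<Rightarrow> nat \<Rightarrow> 'v set" where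
  "split2 d E E' i = (\<Sum>j\<in>{0..i}. range (E' j)) \<inter> (\<Sum>j\<in>{0..d - i}. range (E j))"

text \<open>For a direct sum decomposition \<open>U\<^sub>0, \<dots>, U\<^sub>d\<close> of the whole space this determines the
  linear map \<open>X\<close> uniquely.\<close>

definition acts_on_decomposition ::
    "('k::field \<Rightarrow> 'v::ab_group_add \<Rightarrow> 'v)
      \<Rightarrow> nat \<Rightarrow> 'k \<Rightarrow> (nat \<Rightarrow> 'v set) \<Rightarrow> ('v \<Rightarrow> 'v) \<Rightarrow> bool" where
  "acts_on_decomposition s d q U X \<longleftrightarrow>
     linear_op s X \<and> (\<forall>i\<in>{0..d}. \<forall>v\<in>U i. X v = s (q powi (int d - 2 * int i)) v)"

end

theory Submission
  imports Defs
begin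

text \<open>Put \<open>Q = q\<^sup>2\<close> and let \<open>X\<close> be \<open>Q - 1\<close> times the left-hand side of the identity, so that
  \<open>X\<close> is a quadratic form in \<open>K\<close> and \<open>B\<close>. The goal is \<open>X = 0\<close>, and the kernel of \<open>X\<close> is enlarged
  step by step along the flag \<open>E'\<^sub>0V + \<dots> + E'\<^sub>iV\<close> until it is everything.

  On \<open>U\<^sub>i\<close> the map \<open>A\<close> is the scalar \<open>\<theta>\<^sub>i\<close> plus a raising map into \<open>U\<^bsub>i+1\<^esub>\<close>, while \<open>K\<close> is the scalar
  \<open>q\<^bsup>d-2i\<^esup>\<close>; hence \<open>q K A - q\<^bsup>-1\<^esup> A K = (q - q\<^bsup>-1\<^esup>) (a K\<^sup>2 + a\<^bsup>-1\<^esup>)\<close>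
  (\<open>weight_commutation\<close>). Reversing the order of the eigenspaces of \<open>A\<close> exchanges the two split
  decompositions, so \<open>B\<close> satisfies the same relation with \<open>a\<close> and \<open>a\<^bsup>-1\<^esup>\<close> exchanged. The two
  relations move \<open>A\<close> past \<open>X\<close> at the cost of terms in which \<open>X\<close> is composed with \<open>K\<close> or \<open>B\<close> only
  (\<open>quadratic_form_intertwines\<close>). This is the heart of the matter: if \<open>X\<close> kills \<open>v\<close>, \<open>K v\<close> and
  \<open>B v\<close>, then it kills \<open>A v\<close> (\<open>quadratic_form_kernel\<close>).

  To start the induction, observe that the four coefficients of \<open>X\<close> add up to zero. Thus \<open>X\<close> kills
  any vector that lies in the \<open>i\<close>-th component of both split decompositions, where \<open>K\<close> and \<open>B\<close> are
  the same scalar. Since \<open>K\<close> and \<open>B\<close> preserve the flag, it remains to see that each step of the flag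
  is obtained from the preceding one by applying \<open>A\<close> and adding such common vectors
  (\<open>U_Suc_decomp\<close>).

  This last fact comes from the bijectivity of \<open>(A - \<theta>\<^bsub>d-i-1\<^esub>) \<dots> (A - \<theta>\<^sub>i) : U\<^sub>i \<rightarrow> U\<^bsub>d-i\<^esub>\<close>
  for \<open>2i \<le> d\<close> (\<open>chain_U_surj\<close>). A vector of its kernel lies in
  \<open>(E'\<^sub>0V + \<dots> + E'\<^sub>iV) \<inter> (E\<^sub>0V + \<dots> + E\<^bsub>d-i-1\<^esub>V)\<close>, which is zero by irreducibility
  (\<open>lower_Int_upper\<close> for the reversed system), and the two spaces have the same dimension
  (\<open>dim_U_reflect\<close>).\<close>

section \<open>Spectral resolutions and their flags\<close>

text \<open>If the \<open>P\<^sub>l\<close> are the primitive idempotents of a diagonalizable map, these two sets are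
  \<open>P\<^sub>0V + \<dots> + P\<^bsub>i-1\<^esub>V\<close> and \<open>P\<^sub>iV + \<dots> + P\<^sub>dV\<close>. Describing them by vanishing components makes
  their stability properties immediate. The upper index of the first sum is exclusive, so that the
  zero subspace occurs in both families and the two flags are complementary at equal indices.\<close>

definition lower_sum :: "nat \<Rightarrow> (nat \<Rightarrow> 'v \<Rightarrow> 'v::ab_group_add) \<Rightarrow> nat \<Rightarrow> 'v set" where
  "lower_sum d P i = {v. \<forall>l. i \<le> l \<and> l \<le> d \<longrightarrow> P l v = 0}"

definition upper_sum :: "nat \<Rightarrow> (nat \<Rightarrow> 'v \<Rightarrow> 'v::ab_group_add) \<Rightarrow> nat \<Rightarrow> 'v set" where
  "upper_sum d P i = {v. \<forall>l. l < i \<and> l \<le> d \<longrightarrow> P l v = 0}"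

lemma linear_op_simps:
  assumes "linear_op s f"
  shows linear_op_add: "f (x + y) = f x + f y"
    and linear_op_scale: "f (s c x) = s c (f x)"
    and linear_op_zero: "f 0 = 0"
    and linear_op_diff: "f (x - y) = f x - f y"
    and linear_op_sum: "f (sum g I) = (\<Sum>i\<in>I. f (g i))"
proof -
  interpret Vector_Spaces.linear s s f using assms by (simp add: linear_op_def)
  show "f (x + y) = f x + f y" "f (s c x) = s c (f x)" "f 0 = 0" "f (x - y) = f x - f y"
    "f (sum g I) = (\<Sum>i\<in>I. f (g i))"
    by (simp_all add: add scale zero diff sum)
qed

lemma linear_opI:
  assumes "vector_space s" "\<And>x y. f (x + y) = f x + f y" "\<And>c x. f (s c x) = s c (f x)"
  shows "linear_op s f"
  using assms by (simp add: linear_op_def Vector_Spaces.linear_iff)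

lemma lower_antimono: "i \<le> j \<Longrightarrow> lower_sum d P i \<subseteq> lower_sum d P j"
  by (auto simp: lower_sum_def)

lemma upper_antimono: "i \<le> j \<Longrightarrow> upper_sum d P j \<subseteq> upper_sum d P i"
  by (auto simp: upper_sum_def)

lemma upper_0: "upper_sum d P 0 = UNIV"
  by (auto simp: upper_sum_def)

lemma upper_reverse:
  assumes "k \<le> Suc d"
  shows "upper_sum d (\<lambda>i. P (d - i)) k = lower_sum d P (Suc d - k)"
proof -
  have "(\<forall>l. l < k \<and> l \<le> d \<longrightarrow> P (d - l) v = 0) \<longleftrightarrow>
      (\<forall>l. Suc d - k \<le> l \<and> l \<le> d \<longrightarrow> P l v = 0)" (is "?l \<longleftrightarrow> ?r") for v
  proof
    assume l: ?l
    show ?r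
    proof (intro allI impI)
      fix m assume "Suc d - k \<le> m \<and> m \<le> d"
      then show "P m v = 0" using l[rule_format, of "d - m"] assms by auto
    qed
  next
    assume r: ?r
    show ?l
    proof (intro allI impI)
      fix m assume "m < k \<and> m \<le> d"
      then show "P (d - m) v = 0" using r[rule_format, of "d - m"] assms by auto
    qed
  qed
  then show ?thesis by (simp add: upper_sum_def lower_sum_def)
qed

lemma (in finite_dimensional_vector_space) dim_complementary:
  assumes "subspace S" "subspace T" "S \<inter> T = {0}" "\<And>v. v \<in> W \<longleftrightarrow> (\<exists>x\<in>S. \<exists>y\<in>T. v = x + y)"
  shows "dim W = dim S + dim T"
proof -
  have "W = {x + y |x y. x \<in> S \<and> y \<in> T}" using assms(4) by blast
  then show ?thesis using dim_sums_Int[OF assms(1,2)] assms(3) by simp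
qed

lemma in_sum_ranges:
  assumes "finite I" "\<And>i. i \<in> I \<Longrightarrow> x i \<in> range (P i)"
  shows "(\<Sum>i\<in>I. x i) \<in> (\<Sum>i\<in>I. range (P i :: 'v::ab_group_add \<Rightarrow> 'v))"
  using assms by (auto simp: set_sum_alt)

text \<open>A diagonalizable map is handled through the action of its primitive idempotents \<open>P\<^sub>i\<close>
  alone. In this form its eigenspaces never have to be mentioned, and reversing their order is a
  mere change of index.\<close>

locale spectral_resolution = vector_space scale
  for scale :: "'k::field \<Rightarrow> 'v::ab_group_add \<Rightarrow> 'v" (infixr "*s" 75)
    and X :: "'v \<Rightarrow> 'v" and P :: "nat \<Rightarrow> 'v \<Rightarrow> 'v" and t :: "nat \<Rightarrow> 'k" and d :: nat +
  assumes linear_X: "linear_op scale X"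
    and linear_P: "i \<le> d \<Longrightarrow> linear_op scale (P i)"
    and P_P: "i \<le> d \<Longrightarrow> j \<le> d \<Longrightarrow> P i (P j v) = (if i = j then P i v else 0)"
    and sum_P: "(\<Sum>i\<le>d. P i v) = v"
    and P_X: "i \<le> d \<Longrightarrow> P i (X v) = t i *s P i v"
    and P_nonzero: "i \<le> d \<Longrightarrow> \<exists>v. P i v \<noteq> 0"
    and inj_t: "inj_on t {..d}"
begin

lemmas X_simps = linear_op_simps[OF linear_X]
lemmas P_simps = linear_op_simps[OF linear_P]

lemma eq_0_if_P_0:
  assumes "\<And>i. i \<le> d \<Longrightarrow> P i v = 0"
  shows "v = 0"
  using sum_P[of v] assms by simp

lemma subspace_lower: "subspace (lower_sum d P i)"
  by (auto simp: subspace_def lower_sum_def P_simps)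

lemma subspace_upper: "subspace (upper_sum d P i)"
  by (auto simp: subspace_def upper_sum_def P_simps)

lemma lower_0: "lower_sum d P 0 = {0}"
  using eq_0_if_P_0 by (auto simp: lower_sum_def P_simps)

lemma upper_eq_0: "d < i \<Longrightarrow> upper_sum d P i = {0}"
  using eq_0_if_P_0 by (auto simp: upper_sum_def P_simps)

lemma lower_not_UNIV: "lower_sum d P d \<noteq> UNIV"
  using P_nonzero[of d] by (auto simp: lower_sum_def)

lemma lower_Int_upper: "lower_sum d P i \<inter> upper_sum d P i = {0}"
proof -
  have "v = 0" if "v \<in> lower_sum d P i" "v \<in> upper_sum d P i" for v
    using that eq_0_if_P_0[of v]
    by (auto simp: lower_sum_def upper_sum_def not_less[symmetric])
  then show ?thesis
    using subspace_0[OF subspace_lower] subspace_0[OF subspace_upper] by blast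
qed

lemma lower_plus_upper: "\<exists>x\<in>lower_sum d P i. \<exists>y\<in>upper_sum d P i. v = x + y"
proof -
  let ?x = "\<Sum>l\<in>{..d} \<inter> {..<i}. P l v" and ?y = "\<Sum>l\<in>{..d} - {..<i}. P l v"
  have "?x \<in> lower_sum d P i"
    by (auto simp: lower_sum_def P_simps P_P intro!: sum.neutral)
  moreover have "?y \<in> upper_sum d P i"
    by (auto simp: upper_sum_def P_simps P_P intro!: sum.neutral)
  moreover have "v = ?x + ?y"
    using sum.Int_Diff[of "{..d}" "\<lambda>l. P l v" "{..<i}"] sum_P[of v] by simp
  ultimately show ?thesis by blast
qed

lemma lower_sum_subset_sum_ranges:
  assumes "i \<le> d"
  shows "lower_sum d P (Suc i) \<subseteq> (\<Sum>j\<in>{0..i}. range (P j))"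
proof
  fix v assume v: "v \<in> lower_sum d P (Suc i)"
  have "v = (\<Sum>j\<le>d. P j v)" by (simp add: sum_P)
  also have "\<dots> = (\<Sum>j\<in>{0..i}. P j v)"
    by (rule sum.mono_neutral_right) (use assms v in \<open>auto simp: lower_sum_def\<close>)
  finally show "v \<in> (\<Sum>j\<in>{0..i}. range (P j))"
    using in_sum_ranges[of "{0..i}" "\<lambda>j. P j v" P] by simp
qed

lemma upper_sum_subset_sum_ranges: "upper_sum d P i \<subseteq> (\<Sum>j\<in>{i..d}. range (P j))"
proof
  fix v assume v: "v \<in> upper_sum d P i"
  have "v = (\<Sum>j\<le>d. P j v)" by (simp add: sum_P)
  also have "\<dots> = (\<Sum>j\<in>{i..d}. P j v)"
    by (rule sum.mono_neutral_right) (use v in \<open>auto simp: upper_sum_def\<close>)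
  finally show "v \<in> (\<Sum>j\<in>{i..d}. range (P j))"
    using in_sum_ranges[of "{i..d}" "\<lambda>j. P j v" P] by simp
qed

lemma X_shift_lower:
  assumes "v \<in> lower_sum d P (Suc i)"
  shows "X v - t i *s v \<in> lower_sum d P i"
proof -
  have "P l (X v - t i *s v) = 0" if "i \<le> l" "l \<le> d" for l
    using that assms by (cases "l = i") (auto simp: lower_sum_def P_simps P_X)
  then show ?thesis by (simp add: lower_sum_def)
qed

lemma X_shift_upper:
  assumes "v \<in> upper_sum d P i"
  shows "X v - t i *s v \<in> upper_sum d P (Suc i)"
proof -
  have "P l (X v - t i *s v) = 0" if "l < Suc i" "l \<le> d" for l
    using that assms by (cases "l = i") (auto simp: upper_sum_def P_simps P_X)
  then show ?thesis by (simp add: upper_sum_def)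
qed

text \<open>The factor \<open>X - t\<^sub>h\<close> multiplies the component of \<open>v\<close> at any \<open>l \<noteq> h\<close> by a nonzero scalar, so
  it cannot remove components at the indices \<open>l \<ge> i > h\<close>.\<close>

lemma lower_if_X_shift_lower:
  assumes "X v - t h *s v \<in> lower_sum d P i" and "h < i"
  shows "v \<in> lower_sum d P i"
proof -
  have "P l v = 0" if "i \<le> l" "l \<le> d" for l
  proof -
    have "0 = P l (X v - t h *s v)" using assms that by (simp add: lower_sum_def)
    also have "\<dots> = (t l - t h) *s P l v"
      using that by (simp add: P_simps P_X scale_left_diff_distrib)
    finally have "(t l - t h) *s P l v = 0" by simp
    moreover have "t l \<noteq> t h"
      using that assms(2) inj_onD[OF inj_t, of l h] by auto
    ultimately show ?thesis by simp
  qed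
  then show ?thesis by (simp add: lower_sum_def)
qed

lemma tridiagonal_lower:
  assumes Y: "linear_op scale Y"
    and tri: "\<And>i j v. i \<le> d \<Longrightarrow> j \<le> d \<Longrightarrow> Suc j < i \<or> Suc i < j \<Longrightarrow> P i (Y (P j v)) = 0"
    and v: "v \<in> lower_sum d P i"
  shows "Y v \<in> lower_sum d P (Suc i)"
proof -
  have "P l (Y v) = 0" if "Suc i \<le> l" "l \<le> d" for l
  proof -
    have "P l (Y v) = P l (Y (\<Sum>m\<le>d. P m v))" by (simp add: sum_P)
    also have "\<dots> = (\<Sum>m\<le>d. P l (Y (P m v)))"
      using that by (simp add: linear_op_simps[OF Y] P_simps)
    also have "\<dots> = 0"
    proof (rule sum.neutral, intro ballI)
      fix m assume m: "m \<in> {..d}"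
      show "P l (Y (P m v)) = 0"
      proof (cases "i \<le> m")
        case True
        then have "P m v = 0" using v m by (simp add: lower_sum_def)
        then show ?thesis using that by (simp add: linear_op_simps[OF Y] P_simps)
      next
        case False
        then show ?thesis using that m by (intro tri) auto
      qed
    qed
    finally show ?thesis .
  qed
  then show ?thesis by (simp add: lower_sum_def)
qed

lemma tridiagonal_upper:
  assumes Y: "linear_op scale Y"
    and tri: "\<And>i j v. i \<le> d \<Longrightarrow> j \<le> d \<Longrightarrow> Suc j < i \<or> Suc i < j \<Longrightarrow> P i (Y (P j v)) = 0"
    and v: "v \<in> upper_sum d P i"
  shows "Y v \<in> upper_sum d P (i - 1)"
proof -
  have "P l (Y v) = 0" if "l < i - 1" "l \<le> d" for l
  proof -
    have "P l (Y v) = P l (Y (\<Sum>m\<le>d. P m v))" by (simp add: sum_P)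
    also have "\<dots> = (\<Sum>m\<le>d. P l (Y (P m v)))"
      using that by (simp add: linear_op_simps[OF Y] P_simps)
    also have "\<dots> = 0"
    proof (rule sum.neutral, intro ballI)
      fix m assume m: "m \<in> {..d}"
      show "P l (Y (P m v)) = 0"
      proof (cases "m < i")
        case True
        then have "P m v = 0" using v m by (simp add: upper_sum_def)
        then show ?thesis using that by (simp add: linear_op_simps[OF Y] P_simps)
      next
        case False
        then show ?thesis using that m by (intro tri) auto
      qed
    qed
    finally show ?thesis .
  qed
  then show ?thesis by (simp add: upper_sum_def)
qed

text \<open>The product \<open>(X - t\<^bsub>i+n-1\<^esub>) \<dots> (X - t\<^sub>i)\<close> applied to \<open>v\<close>.\<close>

primrec chain :: "nat \<Rightarrow> nat \<Rightarrow> 'v \<Rightarrow> 'v" where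
  "chain 0 i v = v"
| "chain (Suc n) i v = chain n (Suc i) (X v - t i *s v)"

lemma chain_Suc_last: "chain (Suc n) i v = X (chain n i v) - t (i + n) *s chain n i v"
proof (induction n arbitrary: i v)
  case 0
  then show ?case by simp
next
  case (Suc n)
  have "chain (Suc (Suc n)) i v = chain (Suc n) (Suc i) (X v - t i *s v)" by simp
  also have "\<dots> = X (chain (Suc n) i v) - t (Suc i + n) *s chain (Suc n) i v"
    by (subst Suc.IH) simp
  finally show ?case by simp
qed

lemma linear_chain: "linear_op scale (chain n i)"
proof (induction n arbitrary: i)
  case 0
  show ?case by (rule linear_opI) (auto intro: vector_space_axioms)
next
  case (Suc n)
  note IH = linear_op_simps[OF Suc[of "Suc i"]]
  show ?case
    by (rule linear_opI) (auto intro: vector_space_axioms simp: X_simps IH algebra_simps)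
qed

text \<open>With \<open>0\<close> in place of a general element of the flag, this bounds the kernel of the product:
  it is contained in the sum of the eigenspaces up to the last factor.\<close>

lemma lower_if_chain_lower:
  "chain n h v \<in> lower_sum d P i \<Longrightarrow> h + n \<le> i \<Longrightarrow> v \<in> lower_sum d P i"
proof (induction n arbitrary: h v)
  case (Suc n)
  have "X v - t h *s v \<in> lower_sum d P i"
    using Suc.IH[of "Suc h"] Suc.prems by simp
  then show ?case
    by (rule lower_if_X_shift_lower) (use Suc.prems(2) in simp)
qed simp

lemma spectral_resolution_reverse:
  "spectral_resolution scale X (\<lambda>i. P (d - i)) (\<lambda>i. t (d - i)) d"
proof unfold_locales
  fix v
  have "(\<Sum>i\<le>d. P (d - i) v) = (\<Sum>i\<le>d. P i v)"
    by (rule sum.reindex_bij_witness[of _ "\<lambda>i. d - i" "\<lambda>i. d - i"]) auto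
  then show "(\<Sum>i\<le>d. P (d - i) v) = v" by (simp add: sum_P)
next
  show "inj_on (\<lambda>i. t (d - i)) {..d}"
  proof (rule inj_onI)
    fix x y assume "x \<in> {..d}" "y \<in> {..d}" "t (d - x) = t (d - y)"
    then have "d - x = d - y" by (intro inj_onD[OF inj_t]) auto
    then show "x = y" using \<open>x \<in> {..d}\<close> \<open>y \<in> {..d}\<close> by auto
  qed
qed (auto simp: linear_X linear_P P_P P_X P_nonzero)

end

section \<open>The quadratic form\<close>

text \<open>For \<open>Q = q\<^sup>2\<close> and \<open>a' = a\<^bsup>-1\<^esup>\<close> the fractions \<open>(a\<^bsup>-1\<^esup>q - aq\<^bsup>-1\<^esup>) / (q - q\<^bsup>-1\<^esup>)\<close> and
  \<open>(aq - a\<^bsup>-1\<^esup>q\<^bsup>-1\<^esup>) / (q - q\<^bsup>-1\<^esup>)\<close> become the two middle coefficients upon multiplication by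
  \<open>Q - 1\<close>. Keeping \<open>a'\<close> independent of \<open>a\<close> turns the later calculations into polynomial
  identities.\<close>

definition quadratic_form :: "('k::field \<Rightarrow> 'v::ab_group_add \<Rightarrow> 'v)
    \<Rightarrow> ('v \<Rightarrow> 'v) \<Rightarrow> ('v \<Rightarrow> 'v) \<Rightarrow> 'k \<Rightarrow> 'k \<Rightarrow> 'k \<Rightarrow> 'v \<Rightarrow> 'v" where
  "quadratic_form s K B a a' Q v = s (a * (Q - 1)) (K (K v)) - s (a' * Q - a) (K (B v))
     - s (a * Q - a') (B (K v)) + s (a' * (Q - 1)) (B (B v))"

context vector_space
begin

lemma linear_quadratic_form:
  assumes "linear_op scale K" "linear_op scale B"
  shows "linear_op scale (quadratic_form scale K B a a' Q)"
  by (rule linear_opI)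
    (auto intro: vector_space_axioms simp: quadratic_form_def linear_op_simps[OF assms(1)]
      linear_op_simps[OF assms(2)] algebra_simps)

text \<open>Moving \<open>A\<close> to the right through \<open>X\<close> gives \<open>A X - Q\<^sup>2 X A\<close> as a combination of words in
  \<open>K\<close> and \<open>B\<close> of degree one and three. The linear words cancel, and the cubic part lies in the
  degree-three part of the ideal generated by \<open>X\<close> in the free algebra on \<open>K\<close> and \<open>B\<close>, that is, in
  the span of \<open>K X\<close>, \<open>B X\<close>, \<open>X K\<close>, \<open>X B\<close>. The coefficients in the statement solve the resulting
  linear system of eight equations in four unknowns; the factor \<open>a' - a\<close> clears their common
  denominator.\<close>

lemma quadratic_form_intertwines:
  assumes K: "linear_op scale K" and B: "linear_op scale B" and A: "linear_op scale A"
    and AK: "\<And>v. A (K v) = Q *s K (A v) - (Q - 1) *s (a *s K (K v) + a' *s v)"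
    and AB: "\<And>v. A (B v) = Q *s B (A v) - (Q - 1) *s (a' *s B (B v) + a *s v)"
  defines "X \<equiv> quadratic_form scale K B a a' Q"
  shows "(a' - a) *s A (X v)
      + (Q - 1) *s ((a * (a' * Q - a)) *s K (X v) - (a' * (a * Q - a')) *s B (X v))
    = (Q * Q * (a' - a)) *s X (A v)
      + (Q - 1) *s ((a * (a * Q - a')) *s X (K v) - (a' * (a' * Q - a)) *s X (B v))"
    (is "?l = ?r")
proof -
  note lin = linear_op_simps[OF K] linear_op_simps[OF B] linear_op_simps[OF A]
  (* Opaque names for the coefficients keep the expansion into words small; their values enter only
     when the coefficient of each word is compared with zero. *)
  define m n \<alpha> \<beta> e f p r s t where "m = a' - a" and "n = Q - 1" and "\<alpha> = a' * Q - a"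
    and "\<beta> = a * Q - a'" and "e = a * n" and "f = a' * n"
    and "p = n * a * \<alpha>" and "r = n * a' * \<beta>" and "s = n * a * \<beta>" and "t = n * a' * \<alpha>"
  note defs = m_def n_def \<alpha>_def \<beta>_def e_def f_def p_def r_def s_def t_def
  have X: "X v = e *s K (K v) - \<alpha> *s K (B v) - \<beta> *s B (K v) + f *s B (B v)" for v
    by (simp add: X_def quadratic_form_def defs)
  have AK: "A (K v) = Q *s K (A v) - (n * a) *s K (K v) - (n * a') *s v" for v
    by (simp add: AK n_def scale_right_distrib)
  have AB: "A (B v) = Q *s B (A v) - (n * a') *s B (B v) - (n * a) *s v" for v
    by (simp add: AB n_def scale_right_distrib)
  have "?l - ?r = (m *s A (X v) + (p *s K (X v) - r *s B (X v)))
      - ((Q * Q * m) *s X (A v) + (s *s X (K v) - t *s X (B v)))"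
    by (simp add: defs scale_right_diff_distrib mult.assoc)
  also have "\<dots> = (m * (\<alpha> * n * Q * a + \<beta> * n * a - e * (n * Q + n) * a')) *s K v
      + (m * (\<alpha> * n * a' + \<beta> * n * Q * a' - f * (n * Q + n) * a)) *s B v
      + (p * e - s * e - m * e * (n * Q + n) * a) *s K (K (K v))
      + (m * \<alpha> * n * a - p * \<alpha> + t * e) *s K (K (B v))
      + (s * \<alpha> - p * \<beta>) *s K (B (K v))
      + (m * \<beta> * n * Q * a - r * e + s * \<beta>) *s B (K (K v))
      + (m * \<alpha> * n * Q * a' + p * f - t * \<alpha>) *s K (B (B v))
      + (r * \<alpha> - t * \<beta>) *s B (K (B v))
      + (m * \<beta> * n * a' + r * \<beta> - s * f) *s B (B (K v))
      + (t * f - r * f - m * f * (n * Q + n) * a') *s B (B (B v))"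
    unfolding X
    by (simp add: lin AK AB algebra_simps)
  also have "\<dots> = 0"
  proof -
    have "m * (\<alpha> * n * Q * a + \<beta> * n * a - e * (n * Q + n) * a') = 0"
      "m * (\<alpha> * n * a' + \<beta> * n * Q * a' - f * (n * Q + n) * a) = 0"
      "p * e - s * e - m * e * (n * Q + n) * a = 0"
      "m * \<alpha> * n * a - p * \<alpha> + t * e = 0"
      "s * \<alpha> - p * \<beta> = 0"
      "m * \<beta> * n * Q * a - r * e + s * \<beta> = 0"
      "m * \<alpha> * n * Q * a' + p * f - t * \<alpha> = 0"
      "r * \<alpha> - t * \<beta> = 0"
      "m * \<beta> * n * a' + r * \<beta> - s * f = 0"
      "t * f - r * f - m * f * (n * Q + n) * a' = 0"
      unfolding defs by algebra+
    then show ?thesis by (simp only: scale_zero_left add_0_right)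
  qed
  finally show ?thesis by simp
qed

lemma quadratic_form_kernel:
  assumes "linear_op scale K" "linear_op scale B" "linear_op scale A"
    and "\<And>v. A (K v) = Q *s K (A v) - (Q - 1) *s (a *s K (K v) + a' *s v)"
    and "\<And>v. A (B v) = Q *s B (A v) - (Q - 1) *s (a' *s B (B v) + a *s v)"
    and "Q \<noteq> 0" "a \<noteq> a'"
    and "quadratic_form scale K B a a' Q v = 0"
    and "quadratic_form scale K B a a' Q (K v) = 0" "quadratic_form scale K B a a' Q (B v) = 0"
  shows "quadratic_form scale K B a a' Q (A v) = 0"
  using quadratic_form_intertwines[OF assms(1-5), of v] assms
  by (simp add: linear_op_simps[OF assms(1)] linear_op_simps[OF assms(2)]
      linear_op_simps[OF assms(3)])

end

section \<open>The split decomposition\<close>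

text \<open>The systems considered here carry arbitrary distinct eigenvalues. The axioms are stable under
  reversing the order of the idempotents of \<open>A\<close>, so each result on the first split decomposition
  also yields one on the second.\<close>

locale tridiagonal_system = finite_dimensional_vector_space scale Basis +
  A: spectral_resolution scale A E th d + A': spectral_resolution scale A' E' th' d
  for scale :: "'k::field \<Rightarrow> 'v::ab_group_add \<Rightarrow> 'v" (infixr "*s" 75) and Basis
    and A :: "'v \<Rightarrow> 'v" and E th and A' :: "'v \<Rightarrow> 'v" and E' th' d +
  assumes tridiagonal_A': "\<And>i j v. i \<le> d \<Longrightarrow> j \<le> d \<Longrightarrow> Suc j < i \<or> Suc i < j \<Longrightarrow> E i (A' (E j v)) = 0"
    and tridiagonal_A: "\<And>i j v. i \<le> d \<Longrightarrow> j \<le> d \<Longrightarrow> Suc j < i \<or> Suc i < j \<Longrightarrow> E' i (A (E' j v)) = 0"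
    and irreducible: "subspace W \<Longrightarrow> A ` W \<subseteq> W \<Longrightarrow> A' ` W \<subseteq> W \<Longrightarrow> W = {0} \<or> W = UNIV"
begin

definition U :: "nat \<Rightarrow> 'v set" where
  "U i = lower_sum d E' (Suc i) \<inter> upper_sum d E i"

lemma tridiagonal_system_reverse:
  "tridiagonal_system scale Basis A (\<lambda>i. E (d - i)) (\<lambda>i. th (d - i)) A' E' th' d"
proof -
  interpret R: spectral_resolution scale A "\<lambda>i. E (d - i)" "\<lambda>i. th (d - i)" d
    by (rule A.spectral_resolution_reverse)
  show ?thesis
    by unfold_locales (auto intro!: tridiagonal_A' tridiagonal_A dest: irreducible)
qed

lemma subspace_U: "subspace (U i)"
  by (simp add: U_def subspace_inter A'.subspace_lower A.subspace_upper)

text \<open>The map \<open>A - \<theta>\<^sub>i\<close> removes the lowest component with respect to \<open>A\<close> and, \<open>A\<close> being tridiagonal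
  with respect to the eigenspaces of \<open>A'\<close>, adds at most one component with respect to \<open>A'\<close>. The
  roles are exchanged for \<open>A' - \<theta>'\<^sub>j\<close>.\<close>

lemma A_shift_Int:
  assumes "v \<in> lower_sum d E' j \<inter> upper_sum d E i"
  shows "A v - th i *s v \<in> lower_sum d E' (Suc j) \<inter> upper_sum d E (Suc i)"
proof -
  have "A v \<in> lower_sum d E' (Suc j)"
    using assms by (intro A'.tridiagonal_lower A.linear_X tridiagonal_A) auto
  moreover have "v \<in> lower_sum d E' (Suc j)"
    using assms lower_antimono[of j "Suc j"] by auto
  ultimately have "A v - th i *s v \<in> lower_sum d E' (Suc j)"
    by (intro subspace_diff subspace_scale A'.subspace_lower)
  then show ?thesis using assms A.X_shift_upper by auto
qed

lemma A_shift_U: "v \<in> U i \<Longrightarrow> A v - th i *s v \<in> U (Suc i)"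
  unfolding U_def by (rule A_shift_Int)

lemma A'_shift_Int:
  assumes "v \<in> lower_sum d E' (Suc j) \<inter> upper_sum d E i"
  shows "A' v - th' j *s v \<in> lower_sum d E' j \<inter> upper_sum d E (i - 1)"
proof -
  have "A' v \<in> upper_sum d E (i - 1)"
    using assms by (intro A.tridiagonal_upper A'.linear_X tridiagonal_A') auto
  moreover have "v \<in> upper_sum d E (i - 1)"
    using assms upper_antimono[of "i - 1" i] by auto
  ultimately have "A' v - th' j *s v \<in> upper_sum d E (i - 1)"
    by (intro subspace_diff subspace_scale A.subspace_upper)
  then show ?thesis using assms A'.X_shift_lower by auto
qed

text \<open>The map \<open>A\<close> moves the \<open>i\<close>-th intersection into itself plus the next one, \<open>A'\<close> into itself plus
  the preceding one, so their span is invariant. Both cases are needed: for \<open>r = 0\<close> the span is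
  zero, which makes the two flags independent; for \<open>r = 1\<close> the intersections are the \<open>U\<^sub>i\<close> and
  the span is the whole space.\<close>

lemma span_Int_invariant:
  assumes "r \<le> 1"
  defines "G \<equiv> \<Union>i. lower_sum d E' (i + r) \<inter> upper_sum d E i"
  shows "span G = {0} \<or> span G = UNIV"
proof (rule irreducible)
  show "subspace (span G)" by simp
  have "A v \<in> span G" if "v \<in> G" for v
  proof -
    obtain i where i: "v \<in> lower_sum d E' (i + r) \<inter> upper_sum d E i"
      using \<open>v \<in> G\<close> unfolding G_def by blast
    have "A v - th i *s v \<in> lower_sum d E' (Suc i + r) \<inter> upper_sum d E (Suc i)"
      using A_shift_Int[OF i] by simp
    then have "A v - th i *s v \<in> G" unfolding G_def by blast
    then have "(A v - th i *s v) + th i *s v \<in> span G"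
      using that by (intro span_add span_scale) (auto intro: span_base)
    then show ?thesis by simp
  qed
  moreover have "subspace {v. A v \<in> span G}"
    by (auto simp: subspace_def A.X_simps span_add span_scale span_zero)
  ultimately have "span G \<subseteq> {v. A v \<in> span G}" by (intro span_minimal) auto
  then show "A ` span G \<subseteq> span G" by blast
  have "A' v \<in> span G" if "v \<in> G" for v
  proof -
    obtain i where i: "v \<in> lower_sum d E' (i + r) \<inter> upper_sum d E i"
      using \<open>v \<in> G\<close> unfolding G_def by blast
    show ?thesis
    proof (cases "i + r")
      case 0
      then have "v = 0" using i A'.lower_0 by auto
      then show ?thesis by (simp add: A'.X_simps span_zero)
    next
      case (Suc j)
      then have shift: "A' v - th' j *s v \<in> lower_sum d E' j \<inter> upper_sum d E (i - 1)"
        using A'_shift_Int[of v j i] i by simp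
      have "A' v - th' j *s v \<in> G"
        (* For i = 0 there is no preceding intersection; here r = 1 and the shifted vector lies in
           the zero step of the flag. *)
      proof (cases i)
        case 0
        then have "j = 0" using Suc assms(1) by auto
        then have "A' v - th' j *s v = 0" using shift A'.lower_0 by auto
        moreover have "0 \<in> G"
          unfolding G_def
          using subspace_0[OF A'.subspace_lower] subspace_0[OF A.subspace_upper] by blast
        ultimately show ?thesis by simp
      next
        case (Suc k)
        then have "j = k + r" "i - 1 = k" using \<open>i + r = Suc j\<close> by auto
        then show ?thesis using shift unfolding G_def by blast
      qed
      then have "(A' v - th' j *s v) + th' j *s v \<in> span G"
        using that by (intro span_add span_scale) (auto intro: span_base)
      then show ?thesis by simp
    qed
  qed
  moreover have "subspace {v. A' v \<in> span G}"
    by (auto simp: subspace_def A'.X_simps span_add span_scale span_zero)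
  ultimately have "span G \<subseteq> {v. A' v \<in> span G}" by (intro span_minimal) auto
  then show "A' ` span G \<subseteq> span G" by blast
qed

text \<open>All these intersections lie in \<open>E'\<^sub>0V + \<dots> + E'\<^bsub>d-1\<^esub>V\<close>, which is proper, so irreducibility
  leaves only zero for their span.\<close>

lemma lower_Int_upper: "lower_sum d E' i \<inter> upper_sum d E i = {0}"
proof -
  let ?G = "\<Union>i. lower_sum d E' (i + 0) \<inter> upper_sum d E i"
  have "lower_sum d E' i \<inter> upper_sum d E i \<subseteq> lower_sum d E' d" for i
    using lower_antimono[of i d d E'] A.upper_eq_0[of i] subspace_0[OF A'.subspace_lower]
    by (cases "i \<le> d") auto
  then have "span ?G \<subseteq> lower_sum d E' d"
    by (intro span_minimal A'.subspace_lower) auto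
  then have "span ?G = {0}"
    using span_Int_invariant[of 0] A'.lower_not_UNIV by auto
  then have "lower_sum d E' i \<inter> upper_sum d E i \<subseteq> {0}"
    using span_superset[of ?G] by auto
  then show ?thesis
    using subspace_0[OF A'.subspace_lower] subspace_0[OF A.subspace_upper] by blast
qed

lemma span_U: "span (\<Union>i. U i) = UNIV"
proof -
  obtain v where v: "E' 0 v \<noteq> 0" using A'.P_nonzero[of 0] by auto
  have "E' 0 v \<in> U 0"
    by (auto simp: U_def upper_0 lower_sum_def A'.P_P)
  then have "E' 0 v \<in> span (\<Union>i. U i)" by (intro span_base) auto
  then show ?thesis
    using v span_Int_invariant[of 1] by (auto simp: U_def)
qed

text \<open>The \<open>U\<^sub>h\<close> span \<open>V\<close>, and each of them lies in the first summand if \<open>h < i\<close> and in the second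
  otherwise.\<close>

lemma lower_plus_upper: "\<exists>x\<in>lower_sum d E' i. \<exists>y\<in>upper_sum d E i. v = x + y"
proof -
  let ?W = "{x + y |x y. x \<in> lower_sum d E' i \<and> y \<in> upper_sum d E i}"
  have "subspace ?W"
    by (intro subspace_sums A'.subspace_lower A.subspace_upper)
  moreover have "v \<in> ?W" if "v \<in> U h" for v h
  proof (cases "h < i")
    case True
    then have "v \<in> lower_sum d E' i"
      using that lower_antimono[of "Suc h" i d E'] by (auto simp: U_def)
    moreover have "v = v + 0" by simp
    ultimately show ?thesis using subspace_0[OF A.subspace_upper] by blast
  next
    case False
    then have "v \<in> upper_sum d E i"
      using that upper_antimono[of i h d E] by (auto simp: U_def)
    moreover have "v = 0 + v" by simp
    ultimately show ?thesis using subspace_0[OF A'.subspace_lower] by blast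
  qed
  ultimately have "span (\<Union>h. U h) \<subseteq> ?W"
    by (intro span_minimal) auto
  then show ?thesis using span_U by blast
qed

lemma lower_Suc_decomp:
  assumes "v \<in> lower_sum d E' (Suc i)"
  shows "\<exists>x\<in>lower_sum d E' i. \<exists>u\<in>U i. v = x + u"
proof -
  obtain x y where xy: "x \<in> lower_sum d E' i" "y \<in> upper_sum d E i" "v = x + y"
    using lower_plus_upper by blast
  have "x \<in> lower_sum d E' (Suc i)" using xy lower_antimono[of i "Suc i"] by auto
  then have "v - x \<in> lower_sum d E' (Suc i)"
    by (intro subspace_diff A'.subspace_lower assms)
  then have "y \<in> U i" using xy by (simp add: U_def)
  then show ?thesis using xy by blast
qed

lemma upper_decomp:
  assumes "v \<in> upper_sum d E i"
  shows "\<exists>u\<in>U i. \<exists>y\<in>upper_sum d E (Suc i). v = u + y"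
proof -
  obtain x y where xy: "x \<in> lower_sum d E' (Suc i)" "y \<in> upper_sum d E (Suc i)" "v = x + y"
    using lower_plus_upper by blast
  have "y \<in> upper_sum d E i" using xy upper_antimono[of i "Suc i"] by auto
  then have "v - y \<in> upper_sum d E i"
    by (intro subspace_diff A.subspace_upper assms)
  then have "x \<in> U i" using xy by (simp add: U_def)
  then show ?thesis using xy by blast
qed

lemma dim_lower_upper: "dim (UNIV :: 'v set) = dim (lower_sum d E' i) + dim (upper_sum d E i)"
  by (rule dim_complementary)
    (use A'.subspace_lower A.subspace_upper lower_Int_upper lower_plus_upper in auto)

lemma dim_upper_Suc: "dim (upper_sum d E i) = dim (U i) + dim (upper_sum d E (Suc i))"
proof (rule dim_complementary)
  show "U i \<inter> upper_sum d E (Suc i) = {0}"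
    using lower_Int_upper[of "Suc i"] subspace_0[OF subspace_U]
      subspace_0[OF A.subspace_upper] by (auto simp: U_def)
  fix v
  show "v \<in> upper_sum d E i \<longleftrightarrow> (\<exists>x\<in>U i. \<exists>y\<in>upper_sum d E (Suc i). v = x + y)"
  proof
    assume "\<exists>x\<in>U i. \<exists>y\<in>upper_sum d E (Suc i). v = x + y"
    then obtain x y where "x \<in> U i" "y \<in> upper_sum d E (Suc i)" "v = x + y" by blast
    then show "v \<in> upper_sum d E i"
      using upper_antimono[of i "Suc i" d E] A.subspace_upper[of i]
      by (auto simp: U_def intro!: subspace_add)
  qed (rule upper_decomp)
qed (auto simp: subspace_U A.subspace_upper)

text \<open>Both flags of \<open>A\<close>, the given one and the reversed one, are complementary to the same flag of
  \<open>A'\<close>, hence have equal dimensions at equal indices. On the other hand they are complementary to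
  each other at opposite indices. So the dimensions \<open>h\<^sub>i\<close> of the flag satisfy
  \<open>h\<^sub>i + h\<^bsub>d+1-i\<^esub> = dim V\<close>, and \<open>dim U\<^sub>i = h\<^sub>i - h\<^bsub>i+1\<^esub>\<close> is symmetric.\<close>

lemma dim_U_reflect:
  assumes "i \<le> d"
  shows "dim (U (d - i)) = dim (U i)"
proof -
  interpret R: tridiagonal_system scale Basis A "\<lambda>i. E (d - i)" "\<lambda>i. th (d - i)" A' E' th' d
    by (rule tridiagonal_system_reverse)
  have refl: "dim (UNIV :: 'v set) = dim (upper_sum d E k) + dim (upper_sum d E (Suc d - k))"
    if "k \<le> Suc d" for k
  proof -
    have "dim (upper_sum d E (Suc d - k)) = dim (upper_sum d (\<lambda>i. E (d - i)) (Suc d - k))"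
      using dim_lower_upper[of "Suc d - k"] R.dim_lower_upper[of "Suc d - k"] by linarith
    also have "\<dots> = dim (lower_sum d E k)" using that by (simp add: upper_reverse)
    finally have "dim (upper_sum d E (Suc d - k)) = dim (lower_sum d E k)" .
    moreover have "dim (UNIV :: 'v set) = dim (lower_sum d E k) + dim (upper_sum d E k)"
      by (rule dim_complementary)
        (use A.subspace_lower A.subspace_upper A.lower_Int_upper A.lower_plus_upper in auto)
    ultimately show ?thesis by simp
  qed
  have "dim (upper_sum d E i) + dim (upper_sum d E (Suc (d - i))) =
      dim (upper_sum d E (Suc i)) + dim (upper_sum d E (d - i))"
    using refl[of i] refl[of "Suc i"] assms by (simp add: Suc_diff_le)
  then show ?thesis
    using dim_upper_Suc[of i] dim_upper_Suc[of "d - i"] by linarith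
qed

lemma chain_U: "v \<in> U i \<Longrightarrow> A.chain n i v \<in> U (i + n)"
proof (induction n arbitrary: i v)
  case (Suc n)
  then show ?case using A_shift_U[OF Suc.prems] Suc.IH[of _ "Suc i"] by simp
qed simp

lemma chain_U_surj:
  assumes "2 * i \<le> d"
  shows "A.chain (d - 2 * i) i ` U i = U (d - i)"
proof -
  interpret R: tridiagonal_system scale Basis A "\<lambda>i. E (d - i)" "\<lambda>i. th (d - i)" A' E' th' d
    by (rule tridiagonal_system_reverse)
  interpret fin: finite_dimensional_vector_space_pair_1 scale Basis scale
    by unfold_locales
  let ?f = "A.chain (d - 2 * i) i"
  have lin: "Vector_Spaces.linear scale scale ?f"
    using A.linear_chain by (simp add: linear_op_def)
  interpret lin: Vector_Spaces.linear scale scale ?f by (rule lin)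
  have idx: "i + (d - 2 * i) = d - i" using assms by simp
  have ker: "v = 0" if "v \<in> U i" "?f v = 0" for v
  proof -
    have "?f v \<in> lower_sum d E (d - i)"
      using that subspace_0[OF A.subspace_lower] by simp
    then have "v \<in> lower_sum d E (d - i)"
      by (rule A.lower_if_chain_lower) (simp add: idx)
    then have "v \<in> upper_sum d (\<lambda>i. E (d - i)) (Suc i)"
      using assms by (simp add: upper_reverse)
    then show ?thesis using that R.lower_Int_upper[of "Suc i"] by (auto simp: U_def)
  qed
  have "inj_on ?f (U i)"
  proof (rule inj_onI)
    fix x y assume "x \<in> U i" "y \<in> U i" "?f x = ?f y"
    then have "x - y \<in> U i" "?f (x - y) = 0"
      by (auto simp: linear_op_diff[OF A.linear_chain] intro: subspace_diff[OF subspace_U])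
    then have "x - y = 0" by (rule ker)
    then show "x = y" by simp
  qed
  moreover have "span (U i) = U i" using subspace_U by simp
  ultimately have "inj_on ?f (span (U i))" by (simp only:)
  then have "dim (?f ` U i) = dim (U i)" by (rule fin.dim_image_eq[OF lin])
  then have "dim (?f ` U i) = dim (U (d - i))"
    using dim_U_reflect[of i] assms by simp
  moreover have "?f ` U i \<subseteq> U (d - i)"
    using chain_U[of _ i "d - 2 * i"] idx by auto
  moreover have "subspace (?f ` U i)"
    using lin.subspace_image[OF subspace_U] .
  ultimately show ?thesis
    by (intro subspace_dim_equal subspace_U) auto
qed

text \<open>Let \<open>i = j + 1\<close>. If \<open>2i > d\<close>, the raising map \<open>U\<^sub>j \<rightarrow> U\<^sub>i\<close> is onto as the last factor of
  the surjection \<open>U\<^bsub>d-i\<^esub> \<rightarrow> U\<^sub>i\<close>. Otherwise \<open>U\<^sub>j \<rightarrow> U\<^bsub>d-j\<^esub>\<close> is onto and factors through \<open>U\<^sub>i\<close>,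
  so \<open>u\<close> differs from an element of the image of \<open>U\<^sub>j\<close> by some \<open>k\<close> that
  \<open>(A - \<theta>\<^bsub>d-i\<^esub>) \<dots> (A - \<theta>\<^sub>i)\<close> kills. Such a \<open>k\<close> lies in \<open>E\<^sub>0V + \<dots> + E\<^bsub>d-i\<^esub>V\<close> and thereby in
  the \<open>i\<close>-th component of the second split decomposition.\<close>

lemma U_Suc_decomp:
  assumes "Suc j \<le> d" and u: "u \<in> U (Suc j)"
  shows "\<exists>w\<in>U j. \<exists>k\<in>U (Suc j) \<inter> upper_sum d (\<lambda>i. E (d - i)) (Suc j). u = (A w - th j *s w) + k"
proof (cases "2 * Suc j \<le> d")
  case True
  then obtain m where d: "d = 2 * Suc j + m" by (auto simp: le_iff_add)
  let ?n = "Suc m"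
  have n: "2 * j \<le> d" "d - 2 * j = Suc ?n" "Suc j + ?n = d - j" using d by auto
  have "A.chain ?n (Suc j) u \<in> U (Suc j + ?n)" by (rule chain_U[OF u])
  also have "U (Suc j + ?n) = A.chain (Suc ?n) j ` U j"
    using chain_U_surj[OF n(1)] unfolding n(2) n(3) by (rule sym)
  finally obtain w where w: "w \<in> U j"
      "A.chain ?n (Suc j) u = A.chain ?n (Suc j) (A w - th j *s w)"
    by auto
  let ?k = "u - (A w - th j *s w)"
  have k: "?k \<in> U (Suc j)" by (rule subspace_diff[OF subspace_U u A_shift_U[OF w(1)]])
  have "A.chain ?n (Suc j) ?k = 0"
    using linear_op_diff[OF A.linear_chain, of ?n "Suc j" u "A w - th j *s w"] w(2)
    by (simp only: diff_self)
  then have "A.chain ?n (Suc j) ?k \<in> lower_sum d E (d - j)"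
    by (simp only: subspace_0[OF A.subspace_lower])
  then have "?k \<in> lower_sum d E (d - j)"
    by (rule A.lower_if_chain_lower) (simp only: n(3) order_refl)
  then have "?k \<in> upper_sum d (\<lambda>i. E (d - i)) (Suc j)"
    using assms(1) by (simp add: upper_reverse)
  with k have "?k \<in> U (Suc j) \<inter> upper_sum d (\<lambda>i. E (d - i)) (Suc j)" by (rule IntI)
  moreover have "u = (A w - th j *s w) + ?k" by simp
  ultimately show ?thesis using w(1) by (intro bexI[of _ w] bexI[of _ ?k])
next
  case False
  obtain i where d: "d = Suc j + i" using assms(1) by (auto simp: le_iff_add)
  have "i \<le> j" using False unfolding d by simp
  then obtain m where j: "j = i + m" by (auto simp: le_iff_add)
  have idx: "2 * i \<le> d" "d - 2 * i = Suc m" "d - i = Suc j" unfolding d j by simp_all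
  have "U (Suc j) = A.chain (Suc m) i ` U i"
    using chain_U_surj[OF idx(1)] unfolding idx(2) idx(3) by (rule sym)
  then obtain x where x: "x \<in> U i" "u = A.chain (Suc m) i x"
    using u by blast
  let ?w = "A.chain m i x"
  have "?w \<in> U j" using chain_U[OF x(1), of m] j by simp
  moreover have "u = (A ?w - th j *s ?w) + 0"
    unfolding x(2) A.chain_Suc_last j by (rule add_0_right[symmetric])
  moreover have "0 \<in> U (Suc j) \<inter> upper_sum d (\<lambda>i. E (d - i)) (Suc j)"
    using subspace_0[OF subspace_U] assms(1) subspace_0[OF A.subspace_lower]
    by (simp add: upper_reverse)
  ultimately show ?thesis by (intro bexI[of _ ?w] bexI[of _ 0])
qed

lemma weight_lower:
  assumes K: "linear_op scale K" "\<And>i v. i \<le> d \<Longrightarrow> v \<in> U i \<Longrightarrow> K v = \<kappa> i *s v"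
    and "i \<le> Suc d" "v \<in> lower_sum d E' i"
  shows "K v \<in> lower_sum d E' i"
  using assms(3,4)
proof (induction i arbitrary: v)
  case 0
  then show ?case using A'.lower_0 by (simp add: linear_op_simps[OF K(1)])
next
  case (Suc i)
  obtain x u where xu: "x \<in> lower_sum d E' i" "u \<in> U i" "v = x + u"
    using lower_Suc_decomp[OF Suc.prems(2)] by blast
  have "K x \<in> lower_sum d E' (Suc i)"
    using Suc.IH[of x] xu Suc.prems lower_antimono[of i "Suc i"] by auto
  moreover have "K u \<in> lower_sum d E' (Suc i)"
    using K(2)[of i u] xu Suc.prems subspace_scale[OF A'.subspace_lower] by (auto simp: U_def)
  ultimately show ?case
    using xu by (simp add: linear_op_simps[OF K(1)] subspace_add[OF A'.subspace_lower])
qed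

text \<open>It suffices to check the relation on \<open>U\<^sub>i\<close>, where the raising part \<open>r\<close> of \<open>A\<close> satisfies
  \<open>Q K r = \<kappa>\<^sub>i r\<close> and therefore cancels. What is left is the scalar identity assumed about \<open>\<theta>\<^sub>i\<close>.\<close>

lemma weight_commutation:
  assumes K: "linear_op scale K" "\<And>i v. i \<le> d \<Longrightarrow> v \<in> U i \<Longrightarrow> K v = \<kappa> i *s v"
    and step: "\<And>i. Q * \<kappa> (Suc i) = \<kappa> i"
    and th: "\<And>i. i \<le> d \<Longrightarrow> \<kappa> i * th i = a * \<kappa> i * \<kappa> i + a'"
  shows "A (K v) = Q *s K (A v) - (Q - 1) *s (a *s K (K v) + a' *s v)" (is "?l v = ?r v")
proof -
  note lin = linear_op_simps[OF K(1)] A.X_simps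
  have "v \<in> {v. ?l v = ?r v}" if "v \<in> U i" for i v
  proof (cases "i \<le> d")
    case True
    define r where "r = A v - th i *s v"
    have r: "r \<in> U (Suc i)" using A_shift_U[OF that] by (simp add: r_def)
    have Av: "A v = th i *s v + r" by (simp add: r_def)
    have Kv: "K v = \<kappa> i *s v" using K(2) True that by blast
    have Kr: "Q *s K r = \<kappa> i *s r"
    proof (cases "Suc i \<le> d")
      case True
      then show ?thesis using K(2)[OF True r] step[of i] by simp
    next
      case False
      then have "r = 0" using r A.upper_eq_0[of "Suc i"] by (auto simp: U_def)
      then show ?thesis by (simp add: lin)
    qed
    have "?r v = (Q * (\<kappa> i * th i) - (Q - 1) * (a * \<kappa> i * \<kappa> i + a')) *s v + \<kappa> i *s r"
      by (simp add: Av lin Kv scale_right_distrib Kr algebra_simps)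
    also have "Q * (\<kappa> i * th i) - (Q - 1) * (a * \<kappa> i * \<kappa> i + a') = \<kappa> i * th i"
      using th[OF True] by (simp add: algebra_simps)
    also have "(\<kappa> i * th i) *s v + \<kappa> i *s r = ?l v"
      by (simp add: Kv lin Av scale_right_distrib)
    finally show ?thesis by simp
  next
    case False
    then have "v = 0" using that A.upper_eq_0[of i] by (auto simp: U_def)
    then show ?thesis by (simp add: lin)
  qed
  moreover have "subspace {v. ?l v = ?r v}"
  proof (rule subspaceI, unfold mem_Collect_eq)
    show "?l 0 = ?r 0" by (simp add: lin)
    show "?l (x + y) = ?r (x + y)" if "?l x = ?r x" "?l y = ?r y" for x y
    proof -
      have "?l (x + y) = ?r x + ?r y" by (simp only: lin that)
      also have "\<dots> = ?r (x + y)" by (simp add: lin algebra_simps)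
      finally show ?thesis .
    qed
    show "?l (c *s x) = ?r (c *s x)" if "?l x = ?r x" for c x
    proof -
      have "?l (c *s x) = c *s ?r x" by (simp only: lin that)
      also have "\<dots> = ?r (c *s x)" by (simp add: lin algebra_simps)
      finally show ?thesis .
    qed
  qed
  ultimately have "span (\<Union>i. U i) \<subseteq> {v. ?l v = ?r v}"
    by (intro span_minimal) auto
  then show ?thesis using span_U by auto
qed

text \<open>Induction along the flag \<open>E'\<^sub>0V + \<dots> + E'\<^sub>iV\<close>. Beyond being distinct, the eigenvalues
  of \<open>A\<close> only have to satisfy the two scalar identities \<open>th\<close>; for a system of q-Racah type they hold with
  \<open>\<kappa>\<^sub>i = q\<^bsup>d-2i\<^esup>\<close> and \<open>a' = a\<^bsup>-1\<^esup>\<close>.\<close>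

lemma quadratic_relation:
  assumes K: "linear_op scale K" "\<And>i v. i \<le> d \<Longrightarrow> v \<in> U i \<Longrightarrow> K v = \<kappa> i *s v"
    and B: "linear_op scale B" "\<And>i v. i \<le> d \<Longrightarrow> v \<in> lower_sum d E' (Suc i)
        \<inter> upper_sum d (\<lambda>i. E (d - i)) i \<Longrightarrow> B v = \<kappa> i *s v"
    and step: "\<And>i. Q * \<kappa> (Suc i) = \<kappa> i"
    and th: "\<And>i. i \<le> d \<Longrightarrow> \<kappa> i * th i = a * \<kappa> i * \<kappa> i + a'"
      "\<And>i. i \<le> d \<Longrightarrow> \<kappa> i * th (d - i) = a' * \<kappa> i * \<kappa> i + a"
    and nz: "Q \<noteq> 0" "a \<noteq> a'"
  shows "quadratic_form scale K B a a' Q v = 0"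
proof -
  interpret R: tridiagonal_system scale Basis A "\<lambda>i. E (d - i)" "\<lambda>i. th (d - i)" A' E' th' d
    by (rule tridiagonal_system_reverse)
  let ?X = "quadratic_form scale K B a a' Q"
  have BR: "B v = \<kappa> i *s v" if "i \<le> d" "v \<in> R.U i" for i v
    using B(2) that by (simp add: R.U_def)
  have AK: "A (K v) = Q *s K (A v) - (Q - 1) *s (a *s K (K v) + a' *s v)" for v
    by (rule weight_commutation[OF K step th(1)])
  have AB: "A (B v) = Q *s B (A v) - (Q - 1) *s (a' *s B (B v) + a *s v)" for v
    by (rule R.weight_commutation[OF B(1) BR step th(2)])
  note X = linear_op_simps[OF linear_quadratic_form[OF K(1) B(1)], of a a' Q]
  (* Here K and B are the same scalar, and the coefficients of the form add up to zero. *)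
  have common: "?X u = 0" if "i \<le> d" "u \<in> U i" "u \<in> upper_sum d (\<lambda>i. E (d - i)) i" for u i
  proof -
    have Ku: "K u = \<kappa> i *s u" using K(2) that by blast
    have Bu: "B u = \<kappa> i *s u" using B(2) that by (auto simp: U_def)
    have "?X u = (\<kappa> i * \<kappa> i * (a * (Q - 1) - (a' * Q - a) - (a * Q - a') + a' * (Q - 1))) *s u"
      unfolding quadratic_form_def Ku Bu
      by (simp add: linear_op_simps[OF K(1)] linear_op_simps[OF B(1)] Ku Bu algebra_simps)
    also have "a * (Q - 1) - (a' * Q - a) - (a * Q - a') + a' * (Q - 1) = 0"
      by (simp add: algebra_simps)
    finally show ?thesis by simp
  qed
  have vanish: "?X v = 0" if "i \<le> Suc d" "v \<in> lower_sum d E' i" for i v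
    using that
  proof (induction i arbitrary: v)
    case 0
    then show ?case using A'.lower_0 by (simp add: X)
  next
    case (Suc i)
    obtain x u where xu: "x \<in> lower_sum d E' i" "u \<in> U i" "v = x + u"
      using lower_Suc_decomp[OF Suc.prems(2)] by blast
    have "?X u = 0"
    proof (cases i)
      case 0
      then show ?thesis using xu by (intro common[of 0]) (auto simp: upper_0)
    next
      case (Suc j)
      obtain w k where wk: "w \<in> U j" "k \<in> U i" "k \<in> upper_sum d (\<lambda>i. E (d - i)) i"
          "u = (A w - th j *s w) + k"
        using U_Suc_decomp[of j u] xu Suc \<open>Suc i \<le> Suc d\<close> by auto
      have w: "w \<in> lower_sum d E' i" using wk Suc by (simp add: U_def)
      have IH: "?X y = 0" if "y \<in> lower_sum d E' i" for y
        using Suc.IH that \<open>Suc i \<le> Suc d\<close> by simp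
      have "?X (K w) = 0"
        using weight_lower[OF K _ w] \<open>Suc i \<le> Suc d\<close> by (intro IH) simp
      moreover have "?X (B w) = 0"
        using R.weight_lower[OF B(1) BR _ w] \<open>Suc i \<le> Suc d\<close> by (intro IH) simp
      ultimately have "?X (A w) = 0"
        using quadratic_form_kernel[OF K(1) B(1) A.linear_X AK AB nz IH[OF w]] by simp
      moreover have "?X k = 0"
        using wk \<open>Suc i \<le> Suc d\<close> by (intro common[of i]) auto
      ultimately show ?thesis using wk IH[OF w] by (simp add: X)
    qed
    then show ?case using Suc.IH[of x] xu Suc.prems by (simp add: X)
  qed
  show ?thesis by (rule vanish[of "Suc d"]) (auto simp: lower_sum_def)
qed

end

section \<open>Tridiagonal systems of q-Racah type\<close>

lemma component_cases:
  assumes "x \<in> component d V k"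
  shows "x = 0 \<or> (\<exists>m\<le>d. int m = k \<and> x \<in> V m)"
  using assms by (auto simp: component_def split: if_splits intro!: exI[of _ "nat k"])

text \<open>The eigenspaces span the space, so each identity between linear maps need only be checked on
  one eigenspace at a time, where every idempotent is \<open>0\<close> or \<open>1\<close>.\<close>

lemma (in vector_space) spectral_resolution_if_standard:
  assumes diag: "diagonalizable scale X"
    and ord: "standard_ordering scale X Y d V"
    and prim: "\<forall>i\<in>{0..d}. primitive_idempotent scale X (V i) (P i)"
  shows spectral_resolution_standard:
      "spectral_resolution scale X P (\<lambda>i. eigenvalue_for scale X (P i)) d"
    and tridiagonal_standard: "\<And>i j v. i \<le> d \<Longrightarrow> j \<le> d \<Longrightarrow> linear_op scale Y \<Longrightarrow>
      Suc j < i \<or> Suc i < j \<Longrightarrow> P i (Y (P j v)) = 0"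
proof -
  have X: "linear_op scale X" using diag by (simp add: diagonalizable_def)
  note X_simps = linear_op_simps[OF X]
  have bij: "bij_betw V {0..d} (eigenspaces scale X)"
    using ord by (simp add: standard_ordering_def)
  have P: "linear_op scale (P i)" if "i \<le> d" for i
    using prim that by (simp add: primitive_idempotent_def)
  note P_simps = linear_op_simps[OF P]
  have V: "V i \<in> eigenspaces scale X" if "i \<le> d" for i
    using prim that by (simp add: primitive_idempotent_def)
  define t where "t i = (SOME c. V i = eigenspace scale X c \<and> V i \<noteq> {0})" for i
  have t: "V i = eigenspace scale X (t i) \<and> V i \<noteq> {0}" if "i \<le> d" for i
    unfolding t_def by (rule someI_ex) (use V[OF that] in \<open>auto simp: eigenspaces_def\<close>)
  have sub: "subspace (V i)" if "i \<le> d" for i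
    using t[OF that] by (auto simp: subspace_def eigenspace_def X_simps algebra_simps)
  have P_same: "P i v = v" if "i \<le> d" "v \<in> V i" for i v
    using prim that by (simp add: primitive_idempotent_def)
  have P_other: "P i v = 0" if "i \<le> d" "j \<le> d" "i \<noteq> j" "v \<in> V j" for i j v
  proof -
    have "V j \<noteq> V i" using bij_betw_imp_inj_on[OF bij] that by (auto dest: inj_onD)
    then have "v \<in> \<Union>(eigenspaces scale X - {V i})" using that V by blast
    then have "v \<in> span (\<Union>(eigenspaces scale X - {V i}))" by (rule span_base)
    then show ?thesis using prim that by (simp add: primitive_idempotent_def)
  qed
  have "\<Union>(eigenspaces scale X) = (\<Union>j\<in>{0..d}. V j)"
    using bij by (simp add: bij_betw_def)
  then have span_V: "span (\<Union>j\<in>{0..d}. V j) = UNIV"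
    using diag by (simp add: diagonalizable_def)
  have span_induct_V: "v \<in> S" if "subspace S" "\<And>j v. j \<le> d \<Longrightarrow> v \<in> V j \<Longrightarrow> v \<in> S" for S v
  proof -
    have "span (\<Union>j\<in>{0..d}. V j) \<subseteq> S" using that by (intro span_minimal) auto
    then show ?thesis using span_V by auto
  qed
  have P_V: "P i v \<in> V i" if "i \<le> d" for i v
  proof -
    have "v \<in> {v. P i v \<in> V i}"
    proof (rule span_induct_V)
      show "subspace {v. P i v \<in> V i}"
        using sub[OF that] by (auto simp: subspace_def P_simps[OF that])
      fix j v assume "j \<le> d" "v \<in> V j"
      then show "v \<in> {v. P i v \<in> V i}"
        using P_same P_other[of i j v] that subspace_0[OF sub[OF that]] by (cases "i = j") auto
    qed
    then show ?thesis by simp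
  qed
  have range_P: "range (P i) = V i" if "i \<le> d" for i
  proof
    show "range (P i) \<subseteq> V i" using P_V[OF that] by blast
    show "V i \<subseteq> range (P i)" using P_same[OF that] by (metis rangeI subsetI)
  qed
  have V_nonzero: "\<exists>v\<in>V i. v \<noteq> 0" if "i \<le> d" for i
    using t[OF that] subspace_0[OF sub[OF that]] by blast
  have eigenvalue: "eigenvalue_for scale X (P i) = t i" if "i \<le> d" for i
    unfolding eigenvalue_for_def range_P[OF that]
  proof (rule the_equality)
    show "eigenspace scale X (t i) = V i" using t[OF that] by simp
    fix c assume c: "eigenspace scale X c = V i"
    obtain v where v: "v \<in> V i" "v \<noteq> 0" using V_nonzero[OF \<open>i \<le> d\<close>] by blast
    have "v \<in> eigenspace scale X c" "v \<in> eigenspace scale X (t i)"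
      using v(1) c t[OF \<open>i \<le> d\<close>] by simp_all
    then have "c *s v = t i *s v" by (simp add: eigenspace_def)
    then show "c = t i" using v by simp
  qed
  have P_P: "P i (P j v) = (if i = j then P i v else 0)" if "i \<le> d" "j \<le> d" for i j v
    using P_same[OF that(1)] P_other[OF that] P_V[OF that(2)] P_V[OF that(1)] by auto
  have sum_P: "(\<Sum>i\<le>d. P i v) = v" for v
  proof -
    have "v \<in> {v. (\<Sum>i\<le>d. P i v) = v}"
    proof (rule span_induct_V)
      show "subspace {v. (\<Sum>i\<le>d. P i v) = v}"
        by (auto simp: subspace_def P_simps sum.distrib scale_sum_right[symmetric])
      fix j v assume j: "j \<le> d" "v \<in> V j"
      have "(\<Sum>i\<le>d. P i v) = (\<Sum>i\<le>d. if i = j then v else 0)"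
        using j P_same P_other by (intro sum.cong) auto
      then show "v \<in> {v. (\<Sum>i\<le>d. P i v) = v}" using j by simp
    qed
    then show ?thesis by simp
  qed
  have P_X: "P i (X v) = t i *s P i v" if i: "i \<le> d" for i v
  proof -
    have "v \<in> {v. P i (X v) = t i *s P i v}"
    proof (rule span_induct_V)
      show "subspace {v. P i (X v) = t i *s P i v}"
        by (auto simp: subspace_def P_simps[OF i] X_simps algebra_simps)
      fix j v assume j: "j \<le> d" "v \<in> V j"
      then have "X v = t j *s v" using t by (auto simp: eigenspace_def)
      then show "v \<in> {v. P i (X v) = t i *s P i v}"
        using P_other[OF i j(1) _ j(2)] i by (cases "i = j") (auto simp: P_simps)
    qed
    then show ?thesis by simp
  qed
  show "spectral_resolution scale X P (\<lambda>i. eigenvalue_for scale X (P i)) d"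
  proof unfold_locales
    show "linear_op scale X" by (rule X)
    show "(\<Sum>i\<le>d. P i v) = v" for v by (rule sum_P)
    show "inj_on (\<lambda>i. eigenvalue_for scale X (P i)) {..d}"
    proof (rule inj_onI)
      fix i j assume "i \<in> {..d}" "j \<in> {..d}"
        and "eigenvalue_for scale X (P i) = eigenvalue_for scale X (P j)"
      then have "V i = V j" using t[of i] t[of j] by (simp add: eigenvalue)
      then show "i = j"
        using \<open>i \<in> {..d}\<close> \<open>j \<in> {..d}\<close> bij_betw_imp_inj_on[OF bij] by (auto dest: inj_onD)
    qed
    show "\<exists>v. P i v \<noteq> 0" if "i \<le> d" for i
      using V_nonzero[OF that] P_same[OF that] by metis
    show "P i (X v) = eigenvalue_for scale X (P i) *s P i v" if "i \<le> d" for i v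
      using P_X eigenvalue that by simp
    show "P i (P j v) = (if i = j then P i v else 0)" if "i \<le> d" "j \<le> d" for i j v
      by (rule P_P[OF that])
    show "linear_op scale (P i)" if "i \<le> d" for i by (rule P[OF that])
  qed
  show "P i (Y (P j v)) = 0"
    if "i \<le> d" "j \<le> d" "linear_op scale Y" "Suc j < i \<or> Suc i < j" for i j v
  proof -
    have P_comp: "P i x = 0" if "x \<in> component d V k" "k \<noteq> int i" for x k
      using component_cases[OF that(1)] that(2) \<open>i \<le> d\<close> P_other
      by (auto simp: P_simps)
    have "Y ` V j \<subseteq> component d V (int j - 1) + component d V (int j) + component d V (int j + 1)"
      using ord that(2) by (simp add: standard_ordering_def)
    then have "Y (P j v)
        \<in> component d V (int j - 1) + component d V (int j) + component d V (int j + 1)"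
      using P_V[OF that(2), of v] by blast
    then obtain x y z where "Y (P j v) = x + y + z" "x \<in> component d V (int j - 1)"
        "y \<in> component d V (int j)" "z \<in> component d V (int j + 1)"
      by (auto simp: set_plus_def)
    then show ?thesis using that P_comp by (auto simp: P_simps)
  qed
qed

context tridiagonal_system
begin

lemma U_subset_split1:
  assumes "i \<le> d"
  shows "U i \<subseteq> split1 d E E' i"
  unfolding U_def split1_def
  by (rule Int_mono[OF A'.lower_sum_subset_sum_ranges[OF assms] A.upper_sum_subset_sum_ranges])

lemma reversed_U_subset_split2:
  assumes "i \<le> d"
  shows "lower_sum d E' (Suc i) \<inter> upper_sum d (\<lambda>i. E (d - i)) i \<subseteq> split2 d E E' i"
proof -
  have "upper_sum d (\<lambda>i. E (d - i)) i = lower_sum d E (Suc (d - i))"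
    using assms by (simp add: upper_reverse Suc_diff_le)
  also have "\<dots> \<subseteq> (\<Sum>j\<in>{0..d - i}. range (E j))"
    by (rule A.lower_sum_subset_sum_ranges) simp
  finally show ?thesis
    unfolding split2_def by (intro Int_mono A'.lower_sum_subset_sum_ranges assms)
qed

end

theorem theorem9p9:
  fixes scale :: "'k::alg_closed_field \<Rightarrow> 'v::ab_group_add \<Rightarrow> 'v" (infixr "*s" 75)
    and Basis :: "'v set"
    and A A' K B :: "'v \<Rightarrow> 'v"
    and E E' :: "nat \<Rightarrow> 'v \<Rightarrow> 'v"
    and d :: nat
    and q a b :: 'k
  assumes "finite_dimensional_vector_space scale Basis"
    and "(UNIV :: 'v set) \<noteq> {0}"
    and "d \<ge> 1"
    and "TD_system scale d A E A' E'"
    and "q_Racah scale d A E A' E' q a b"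
    and "acts_on_decomposition scale d q (split1 d E E') K"
    and "acts_on_decomposition scale d q (split2 d E E') B"
  shows "(\<lambda>v. a *s (K ^^ 2) v
            - ((inverse a * q - a * inverse q) / (q - inverse q)) *s (K \<circ> B) v
            - ((a * q - inverse a * inverse q) / (q - inverse q)) *s (B \<circ> K) v
            + inverse a *s (B ^^ 2) v) = (\<lambda>v. 0)"
proof -
  interpret finite_dimensional_vector_space scale Basis by (rule assms(1))
  have TD: "diagonalizable scale A" "diagonalizable scale A'"
    "\<And>W. subspace W \<Longrightarrow> A ` W \<subseteq> W \<Longrightarrow> A' ` W \<subseteq> W \<Longrightarrow> W = {0} \<or> W = UNIV"
    using assms(4) unfolding TD_system_def TD_pair_def by blast+
  then have lin: "linear_op scale A" "linear_op scale A'" by (simp_all add: diagonalizable_def)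
  obtain V V' where V: "standard_ordering scale A A' d V"
      "\<forall>i\<in>{0..d}. primitive_idempotent scale A (V i) (E i)"
    and V': "standard_ordering scale A' A d V'"
      "\<forall>i\<in>{0..d}. primitive_idempotent scale A' (V' i) (E' i)"
    using assms(4) unfolding TD_system_def standard_idempotents_def by blast
  interpret A: spectral_resolution scale A E "\<lambda>i. eigenvalue_for scale A (E i)" d
    by (rule spectral_resolution_standard[OF TD(1) V])
  interpret A': spectral_resolution scale A' E' "\<lambda>i. eigenvalue_for scale A' (E' i)" d
    by (rule spectral_resolution_standard[OF TD(2) V'])
  interpret tridiagonal_system scale Basis A E "\<lambda>i. eigenvalue_for scale A (E i)"
      A' E' "\<lambda>i. eigenvalue_for scale A' (E' i)" d
    by unfold_locales
      (fact tridiagonal_standard[OF TD(1) V _ _ lin(2)] tridiagonal_standard[OF TD(2) V' _ _ lin(1)]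
        TD(3))+
  have q: "q \<noteq> 0" "q ^ 4 \<noteq> 1"
    and th: "\<And>i. i \<le> d \<Longrightarrow> eigenvalue_for scale A (E i) =
      a * q powi (int d - 2 * int i) + inverse a * q powi (2 * int i - int d)"
    using assms(5) by (auto simp: q_Racah_def)
  have q2: "q ^ 2 \<noteq> 1"
    using q(2) by (metis power_even_eq[of q 2] mult_2 numeral_Bit0 power_one)
  define \<kappa> where "\<kappa> i = q powi (int d - 2 * int i)" for i
  have \<kappa>_inverse: "\<kappa> i * q powi (2 * int i - int d) = 1" for i
    using q(1) by (simp add: \<kappa>_def power_int_add[symmetric])
  have step: "q ^ 2 * \<kappa> (Suc i) = \<kappa> i" for i
  proof -
    have "q ^ 2 * \<kappa> (Suc i) = q powi 2 * q powi (int d - 2 * int (Suc i))" by (simp add: \<kappa>_def)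
    also have "\<dots> = q powi (2 + (int d - 2 * int (Suc i)))"
      using q(1) by (simp only: power_int_add simp_thms)
    finally show ?thesis by (simp add: \<kappa>_def)
  qed
  have th1: "\<kappa> i * eigenvalue_for scale A (E i) = a * \<kappa> i * \<kappa> i + inverse a" if "i \<le> d" for i
  proof -
    have "\<kappa> i * eigenvalue_for scale A (E i)
        = a * \<kappa> i * \<kappa> i + inverse a * (\<kappa> i * q powi (2 * int i - int d))"
      unfolding th[OF that] \<kappa>_def[symmetric] by (simp add: distrib_left mult_ac)
    then show ?thesis by (simp only: \<kappa>_inverse mult_1_right)
  qed
  have th2: "\<kappa> i * eigenvalue_for scale A (E (d - i)) = inverse a * \<kappa> i * \<kappa> i + a"
    if "i \<le> d" for i
  proof -
    have idx: "int d - 2 * int (d - i) = 2 * int i - int d"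
        "2 * int (d - i) - int d = int d - 2 * int i"
      using that by auto
    have "\<kappa> i * eigenvalue_for scale A (E (d - i))
        = inverse a * \<kappa> i * \<kappa> i + a * (\<kappa> i * q powi (2 * int i - int d))"
      unfolding th[OF diff_le_self] idx \<kappa>_def[symmetric] by (simp add: distrib_left mult_ac)
    then show ?thesis by (simp only: \<kappa>_inverse mult_1_right)
  qed
  (* This is where d > 0 enters: a = 1/a would force the first and last eigenvalues of A to agree. *)
  have "a \<noteq> inverse a"
  proof
    assume "a = inverse a"
    then have "eigenvalue_for scale A (E 0) = eigenvalue_for scale A (E d)"
      using th[of 0] th[of d] by simp
    then show False using inj_onD[OF A.inj_t, of 0 d] assms(3) by simp
  qed
  have K: "K v = \<kappa> i *s v" if "i \<le> d" "v \<in> U i" for i v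
    using assms(6) subsetD[OF U_subset_split1[OF that(1)] that(2)] that(1)
    by (auto simp: acts_on_decomposition_def \<kappa>_def)
  have B: "B v = \<kappa> i *s v"
    if "i \<le> d" "v \<in> lower_sum d E' (Suc i) \<inter> upper_sum d (\<lambda>i. E (d - i)) i" for i v
    using assms(7) subsetD[OF reversed_U_subset_split2[OF that(1)] that(2)] that(1)
    by (auto simp: acts_on_decomposition_def \<kappa>_def)
  have linKB: "linear_op scale K" "linear_op scale B"
    using assms(6,7) by (auto simp: acts_on_decomposition_def)
  have rel: "quadratic_form scale K B a (inverse a) (q ^ 2) v = 0" for v
    by (rule quadratic_relation[where \<kappa> = \<kappa>])
      (use linKB K B step th1 th2 q(1) \<open>a \<noteq> inverse a\<close> in auto)
  have coeff: "(x * q - y * inverse q) / (q - inverse q) = (x * q ^ 2 - y) / (q ^ 2 - 1)" for x y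
  proof -
    have "(x * q - y * inverse q) / (q - inverse q)
        = (q * (x * q - y * inverse q)) / (q * (q - inverse q))"
      using q(1) by simp
    also have "q * (x * q - y * inverse q) = x * q ^ 2 - y"
      using q(1) by (simp add: power2_eq_square algebra_simps)
    also have "q * (q - inverse q) = q ^ 2 - 1"
      using q(1) by (simp add: power2_eq_square algebra_simps)
    finally show ?thesis .
  qed
  show ?thesis
  proof
    fix v
    let ?w = "a *s (K ^^ 2) v
            - ((inverse a * q - a * inverse q) / (q - inverse q)) *s (K \<circ> B) v
            - ((a * q - inverse a * inverse q) / (q - inverse q)) *s (B \<circ> K) v
            + inverse a *s (B ^^ 2) v"
    have "(q ^ 2 - 1) *s ?w = quadratic_form scale K B a (inverse a) (q ^ 2) v"
      unfolding coeff quadratic_form_def using q2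
      by (simp add: scale_right_distrib scale_right_diff_distrib numeral_2_eq_2
          mult.commute)
    then show "?w = 0" using rel[of v] q2 by simp
  qed
qed

end
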